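(* Let $B\in\mathbb R^{d\times r}$ and $k\in\mathbb Z_{>0}^r$. Set $Y=B^{(2k)}$ and $n=2\sum_{t=1}^r k_t$. Then $$\sigma(Y)=\sum_{t=1}^r(2k_t-1)+\dim L_k(B).$$ In particular, the sign vectors in $\ker Y$ span $\ker Y$ if and only if $L_k(B)=\ker B$.
   Context: For $m\in\mathbb Z_{>0}^r$, $B^{(m)}$ is the matrix obtained by repeating the $t$th column of $B$ exactly $m_t$ times (the columns of $B$ need not be distinct or nonzero, and $B$ need not have full row rank). For a matrix $Y$ with $n$ columns, $\sigma(Y)=\dim\operatorname{span}(\ker Y\cap\{-1,1\}^n)$. For $k\in\mathbb Z_{>0}^r$, $L_k(B)=\operatorname{span}\{z\in\ker B\cap\mathbb Z^r:|z_t|\le k_t\text{ for every }t\}$. All spans are real linear spans, with $\operatorname{span}\varnothing=\{0\}$; sign vectors have entries in $\{-1,1\}$. *)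

theory Defs
  imports
    "Jordan_Normal_Form.Matrix_Kernel"
    "Jordan_Normal_Form.DL_Rank"
begin

definition real_span :: "nat \<Rightarrow> real vec set \<Rightarrow> real vec set" where
  "real_span n S = LinearCombinations.module.span class_ring (module_vec TYPE(real) n) S"

(* Meaningful when W is (the carrier of) a linear subspace of R^n. *)
definition subspace_dim :: "nat \<Rightarrow> real vec set \<Rightarrow> nat" where
  "subspace_dim n W = vectorspace.dim class_ring ((module_vec TYPE(real) n)\<lparr>carrier := W\<rparr>)"

(* B^(m), for m a vector with dim_col B entries; the copies of a column are adjacent
   and the blocks keep the order of the columns of B. *)
definition repeat_cols :: "real mat \<Rightarrow> nat vec \<Rightarrow> real mat" where
  "repeat_cols B m =
     mat_of_cols (dim_row B) (concat (map (\<lambda>t. replicate (m $ t) (col B t)) [0..<dim_col B]))"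

definition sign_vecs :: "nat \<Rightarrow> real vec set" where
  "sign_vecs n = {v \<in> carrier_vec n. \<forall>i<n. v $ i \<in> {-1, 1}}"

definition sigma :: "real mat \<Rightarrow> nat" where
  "sigma Y = subspace_dim (dim_col Y) (real_span (dim_col Y) (mat_kernel Y \<inter> sign_vecs (dim_col Y)))"

definition L :: "nat vec \<Rightarrow> real mat \<Rightarrow> real vec set" where
  "L k B = real_span (dim_col B)
     {z \<in> mat_kernel B. \<forall>t<dim_col B. z $ t \<in> \<int> \<and> \<bar>z $ t\<bar> \<le> real (k $ t)}"

end

theory Submission
  imports Defs
begin

text \<open>
  Group the $n$ columns of $Y$ into blocks, block $t$ holding the $2k_t$ copies of column $t$ of $B$,
  and let $P$ be the map that adds up the entries of a vector over each block. Then $Y = BP$, so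
  $\ker Y = P^{-1}(\ker B)$, and everything follows from the description (lemma \<open>S_eq_vimage\<close>)
  of the span $S$ of the sign vectors in $\ker Y$ as $S = P^{-1}(L_k(B))$.

  The block sums of a sign vector are even and bounded by $2k_t$, because the blocks have even size
  $2k_t$. Hence $\frac12 Px$ is one of the generators of $L_k(B)$ for every sign vector $x \in \ker Y$.
  Conversely, a generator $z$ is reached by putting $k_t + z_t$ entries $+1$ into block $t$. It remains
  to see $\ker P \subseteq S$ (lemma \<open>kernel_P_subset_S\<close>). The space $\ker P$ is spanned by the
  vectors $e_i - e_j$ with $i \neq j$ in one block, and $2(e_i - e_j)$ is the difference of two sign
  vectors with all block sums $0$, which differ only by exchanging the values at $i$ and $j$.

  Since every block is nonempty, $P$ is onto. Rank-nullity for $P$ on the whole space gives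
  $\dim\ker P = n - r = \sum_t (2k_t - 1)$, and rank-nullity for $P$ on $S$ gives
  $\dim S = \dim L_k(B) + \dim\ker P$. The last claim holds because a surjective $P$ makes
  $P^{-1}(L_k(B)) = P^{-1}(\ker B)$ equivalent to $L_k(B) = \ker B$.
\<close>

section \<open>Subspaces of \<open>\<real>\<^sup>n\<close>\<close>

lemma submodule_vec_iff:
  "submodule class_ring W (module_vec TYPE(real) n) \<longleftrightarrow>
     W \<subseteq> carrier_vec n \<and> 0\<^sub>v n \<in> W \<and> (\<forall>v\<in>W. \<forall>w\<in>W. v + w \<in> W) \<and> (\<forall>c. \<forall>v\<in>W. c \<cdot>\<^sub>v v \<in> W)"
  using vec_module[where 'a = real, of n]
  by (auto simp: submodule_def module_vec_simps class_ring_simps)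

lemma
  assumes "G \<subseteq> carrier_vec n"
  shows real_span_submodule: "submodule class_ring (real_span n G) (module_vec TYPE(real) n)"
    and real_span_superset: "G \<subseteq> real_span n G"
proof -
  interpret vec_space "TYPE(real)" n .
  show "submodule class_ring (real_span n G) (module_vec TYPE(real) n)"
    using span_is_submodule assms unfolding real_span_def by auto
  show "G \<subseteq> real_span n G"
    using in_own_span assms unfolding real_span_def by auto
qed

lemma real_span_minimal:
  assumes "G \<subseteq> W" and "submodule class_ring W (module_vec TYPE(real) n)"
  shows "real_span n G \<subseteq> W"
proof -
  interpret vec_space "TYPE(real)" n .
  show ?thesis using span_is_subset[OF assms] unfolding real_span_def .
qed

lemma submodule_mat_kernel:
  assumes "A \<in> carrier_mat d n"
  shows "submodule class_ring (mat_kernel A) (module_vec TYPE(real) n)"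
  unfolding submodule_vec_iff mat_kernel[OF assms]
  using assms by (auto simp: mult_add_distrib_mat_vec[OF assms] mult_mat_vec[OF assms])

lemma submodule_vimage:
  assumes P: "P \<in> carrier_mat r n" and W: "submodule class_ring W (module_vec TYPE(real) r)"
  shows "submodule class_ring {x \<in> carrier_vec n. P *\<^sub>v x \<in> W} (module_vec TYPE(real) n)"
proof -
  have "P *\<^sub>v 0\<^sub>v n = 0\<^sub>v r" using P by auto
  thus ?thesis using W unfolding submodule_vec_iff
    by (auto simp: mult_add_distrib_mat_vec[OF P] mult_mat_vec[OF P])
qed

text \<open>Rank-nullity for the restriction of a matrix to a subspace. The subspace is given by a finite
  set of generators so that it is visibly finite-dimensional.\<close>
lemma subspace_dim_image_kernel:
  assumes P: "P \<in> carrier_mat r n" and G: "G \<subseteq> carrier_vec n" "finite G"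
  shows "subspace_dim r ((\<lambda>x. P *\<^sub>v x) ` real_span n G)
       + subspace_dim n {x \<in> real_span n G. P *\<^sub>v x = 0\<^sub>v r} = subspace_dim n (real_span n G)"
proof -
  interpret N: vec_space "TYPE(real)" n .
  interpret R: vec_space "TYPE(real)" r .
  let ?V = "(module_vec TYPE(real) n)\<lparr>carrier := real_span n G\<rparr>"
  let ?W = "module_vec TYPE(real) r"
  have sub: "submodule class_ring (real_span n G) (module_vec TYPE(real) n)"
    by (rule real_span_submodule[OF G(1)])
  hence S: "real_span n G \<subseteq> carrier_vec n" by (simp add: submodule_vec_iff)
  have V: "vectorspace class_ring ?V"
    using N.subspace_is_vs[unfolded subspace_def] sub vec_vs by blast
  have "linear_map class_ring ?V ?W (\<lambda>x. P *\<^sub>v x)"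
  proof (intro linear_map.intro mod_hom.intro mod_hom_axioms.intro)
    show "(\<lambda>x. P *\<^sub>v x) \<in> LinearCombinations.module_hom class_ring ?V ?W"
      using S P unfolding LinearCombinations.module_hom_def
      by (auto simp: module_vec_simps class_ring_simps mult_add_distrib_mat_vec[OF P]
          mult_mat_vec[OF P] subset_iff)
  qed (use V vec_vs in \<open>auto simp: vectorspace_def\<close>)
  then interpret T: linear_map class_ring ?V ?W "\<lambda>x. P *\<^sub>v x" .
  have "T.V.fin_dim"
    using N.fin_dim_span G unfolding real_span_def by auto
  from T.rank_nullity[OF this] show ?thesis
    unfolding T.im_def T.ker_def subspace_dim_def by (simp add: module_vec_simps)
qed

lemma subspace_dim_carrier: "subspace_dim n (carrier_vec n) = n"
proof -
  interpret vec_space "TYPE(real)" n .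
  have "(module_vec TYPE(real) n)\<lparr>carrier := carrier_vec n\<rparr> = module_vec TYPE(real) n"
    by (simp add: module_vec_def)
  thus ?thesis unfolding subspace_dim_def by (simp only: dim_is_n)
qed

lemma subspace_dim_mat_kernel_of_surj:
  assumes P: "P \<in> carrier_mat r n" and surj: "(\<lambda>x. P *\<^sub>v x) ` carrier_vec n = carrier_vec r"
  shows "r + subspace_dim n (mat_kernel P) = n"
proof -
  interpret vec_space "TYPE(real)" n .
  have span: "real_span n (set (unit_vecs n)) = carrier_vec n"
    using span_unit_vecs_is_carrier unfolding real_span_def .
  show ?thesis
    using subspace_dim_image_kernel[OF P, of "set (unit_vecs n)"] surj
    unfolding span by (auto simp: subspace_dim_carrier mat_kernel[OF P] unit_vecs_carrier)
qed

section \<open>Sign vectors and block sums\<close>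

definition signing :: "nat \<Rightarrow> nat set \<Rightarrow> real vec" where
  "signing n F = vec n (\<lambda>j. if j \<in> F then 1 else - 1)"

lemma signing_carrier[simp]: "signing n F \<in> carrier_vec n"
  by (simp add: signing_def)

lemma signing_mem_sign_vecs: "signing n F \<in> sign_vecs n"
  by (auto simp: signing_def sign_vecs_def)

lemma sign_vecs_eq_image_signing: "sign_vecs n = signing n ` Pow {..<n}"
proof
  show "sign_vecs n \<subseteq> signing n ` Pow {..<n}"
  proof
    fix v assume "v \<in> sign_vecs n"
    hence "v = signing n {j \<in> {..<n}. v $ j = 1}"
      by (intro eq_vecI) (auto simp: sign_vecs_def signing_def)
    thus "v \<in> signing n ` Pow {..<n}" by blast
  qed
qed (auto simp: signing_mem_sign_vecs)

definition block :: "nat \<Rightarrow> (nat \<Rightarrow> nat) \<Rightarrow> nat \<Rightarrow> nat set" where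
  "block n b t = {j \<in> {..<n}. b j = t}"

lemma finite_block[simp]: "finite (block n b t)"
  by (simp add: block_def)

definition block_sum_mat :: "nat \<Rightarrow> nat \<Rightarrow> (nat \<Rightarrow> nat) \<Rightarrow> real mat" where
  "block_sum_mat r n b = mat r n (\<lambda>(t, j). if b j = t then 1 else 0)"

lemma block_sum_mat_carrier[simp]: "block_sum_mat r n b \<in> carrier_mat r n"
  by (simp add: block_sum_mat_def)

lemma block_sum_mat_mult_vec:
  assumes x: "x \<in> carrier_vec n"
  shows "block_sum_mat r n b *\<^sub>v x = vec r (\<lambda>t. \<Sum>j\<in>block n b t. x $ j)"
proof (rule eq_vecI)
  fix t assume "t < dim_vec (vec r (\<lambda>t. \<Sum>j\<in>block n b t. x $ j))"
  hence t: "t < r" by simp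
  have "(block_sum_mat r n b *\<^sub>v x) $ t = (\<Sum>j<n. if b j = t then x $ j else 0)"
    using t x by (auto simp: block_sum_mat_def scalar_prod_def lessThan_atLeast0 intro!: sum.cong)
  also have "\<dots> = (\<Sum>j\<in>block n b t. x $ j)"
    unfolding block_def by (rule sum.inter_filter[symmetric]) simp
  finally show "(block_sum_mat r n b *\<^sub>v x) $ t = vec r (\<lambda>t. \<Sum>j\<in>block n b t. x $ j) $ t"
    using t by simp
qed (simp add: block_sum_mat_def)

lemma sum_signing_block:
  "(\<Sum>j\<in>block n b t. signing n F $ j) = 2 * real (card (F \<inter> block n b t)) - real (card (block n b t))"
proof -
  have "(\<Sum>j\<in>block n b t. signing n F $ j) = (\<Sum>j\<in>block n b t. 2 * (if j \<in> F then 1 else 0) - 1)"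
    by (intro sum.cong) (auto simp: signing_def block_def)
  also have "\<dots> = 2 * (\<Sum>j\<in>block n b t. if j \<in> F then 1 else 0) - real (card (block n b t))"
    by (simp add: sum_subtractf sum_distrib_left)
  also have "(\<Sum>j\<in>block n b t. if j \<in> F then 1 else (0::real)) = real (card (F \<inter> block n b t))"
    by (simp add: sum.If_cases Int_commute)
  finally show ?thesis .
qed

text \<open>The vectors $e_i - e_j$ with $i$ and $j$ in one block span the vectors whose block sums
  vanish. If such a vector is nonzero at $i$, then it is nonzero at a second position $j$ of the
  same block, and subtracting $x_i(e_i - e_j)$ clears position $i$ without touching any position
  outside the support; so the support shrinks and induction applies.\<close>
lemma mat_kernel_block_sum_mat_subset:
  assumes S: "submodule class_ring S (module_vec TYPE(real) n)"
    and diff: "\<And>i j. i < n \<Longrightarrow> j < n \<Longrightarrow> i \<noteq> j \<Longrightarrow> b i = b j \<Longrightarrow> unit_vec n i - unit_vec n j \<in> S"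
    and b: "\<And>j. j < n \<Longrightarrow> b j < r"
  shows "mat_kernel (block_sum_mat r n b) \<subseteq> S"
proof
  let ?P = "block_sum_mat r n b"
  have P: "?P \<in> carrier_mat r n" by simp
  have Ker: "submodule class_ring (mat_kernel ?P) (module_vec TYPE(real) n)"
    by (rule submodule_mat_kernel[OF P])
  fix x assume "x \<in> mat_kernel ?P"
  thus "x \<in> S"
  proof (induction "card {i \<in> {..<n}. x $ i \<noteq> 0}" arbitrary: x rule: less_induct)
    case less
    have x: "x \<in> carrier_vec n" and Px: "?P *\<^sub>v x = 0\<^sub>v r"
      using mat_kernelD[OF P less.prems] by auto
    show ?case
    proof (cases "\<exists>i<n. x $ i \<noteq> 0")
      case False
      hence "x = 0\<^sub>v n" using x by (intro eq_vecI) auto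
      thus ?thesis using S by (simp add: submodule_vec_iff)
    next
      case True
      then obtain i where i: "i < n" "x $ i \<noteq> 0" by blast
      have sum0: "(\<Sum>l\<in>block n b (b i). x $ l) = 0"
        using arg_cong[OF Px, of "\<lambda>v. v $ b i"] b[OF i(1)] by (simp add: block_sum_mat_mult_vec[OF x])
      obtain j where j: "j < n" "j \<noteq> i" "b i = b j" "x $ j \<noteq> 0"
      proof -
        have "i \<in> block n b (b i)" using i by (simp add: block_def)
        hence "(\<Sum>l\<in>block n b (b i) - {i}. x $ l) \<noteq> 0"
          using sum0 i(2) by (simp add: sum.remove[of _ i])
        then obtain j where "j \<in> block n b (b i) - {i}" "x $ j \<noteq> 0"
          by (meson sum.not_neutral_contains_not_neutral)
        thus thesis using that[of j] by (auto simp: block_def)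
      qed
      let ?u = "unit_vec n i - unit_vec n j :: real vec"
      have u: "?u \<in> carrier_vec n" by simp
      define y where "y = x + (- x $ i) \<cdot>\<^sub>v ?u"
      have y: "y \<in> carrier_vec n" using x by (simp add: y_def)
      have yl: "y $ l = x $ l - x $ i * ((if l = i then 1 else 0) - (if l = j then 1 else 0))"
        if "l < n" for l
        using that x i j by (auto simp: y_def)
      have "?P *\<^sub>v ?u = 0\<^sub>v r"
      proof (rule eq_vecI)
        fix t assume "t < dim_vec (0\<^sub>v r :: real vec)"
        hence t: "t < r" by simp
        have "(\<Sum>l\<in>block n b t. ?u $ l)
            = (\<Sum>l\<in>block n b t. (if l = i then 1 else 0) - (if l = j then 1 else 0))"
          using i j by (intro sum.cong) (auto simp: block_def)
        also have "\<dots> = 0" using i j by (auto simp: sum_subtractf block_def)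
        finally show "(?P *\<^sub>v ?u) $ t = 0\<^sub>v r $ t" using t
          by (simp add: block_sum_mat_mult_vec[OF u])
      qed (simp add: block_sum_mat_def)
      hence uK: "?u \<in> mat_kernel ?P" by (intro mat_kernelI[OF P u])
      hence yK: "y \<in> mat_kernel ?P"
        using Ker less.prems unfolding y_def submodule_vec_iff by blast
      have "{l \<in> {..<n}. y $ l \<noteq> 0} \<subset> {l \<in> {..<n}. x $ l \<noteq> 0}"
      proof
        have "y $ i = 0" using yl[OF i(1)] j(2) by simp
        thus "{l \<in> {..<n}. y $ l \<noteq> 0} \<noteq> {l \<in> {..<n}. x $ l \<noteq> 0}" using i by blast
        have "x $ l \<noteq> 0" if "l < n" "y $ l \<noteq> 0" for l
          using that i(2) j(4) yl[OF that(1)] by (cases "l = i \<or> l = j") auto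
        thus "{l \<in> {..<n}. y $ l \<noteq> 0} \<subseteq> {l \<in> {..<n}. x $ l \<noteq> 0}" by blast
      qed
      hence "card {l \<in> {..<n}. y $ l \<noteq> 0} < card {l \<in> {..<n}. x $ l \<noteq> 0}"
        by (intro psubset_card_mono) auto
      from less.hyps[OF this yK] have "y \<in> S" .
      moreover have "x = y + x $ i \<cdot>\<^sub>v ?u"
        using x y by (intro eq_vecI) (auto simp: y_def algebra_simps)
      moreover have "?u \<in> S" using diff i j by simp
      ultimately show ?thesis using S unfolding submodule_vec_iff by metis
    qed
  qed
qed

section \<open>The span of the sign vectors in the kernel\<close>

text \<open>The blocks are the fibres of a map \<open>b\<close> from positions to block indices. Only their sizes
  enter the argument, not the order in which the copies of the columns are listed.\<close>
locale even_blocks =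
  fixes r n :: nat and b k :: "nat \<Rightarrow> nat" and B :: "real mat" and d :: nat
  assumes block_lt: "j < n \<Longrightarrow> b j < r"
    and card_block: "t < r \<Longrightarrow> card (block n b t) = 2 * k t"
    and k_pos: "t < r \<Longrightarrow> 0 < k t"
    and B: "B \<in> carrier_mat d r"
begin

abbreviation "P \<equiv> block_sum_mat r n b"

definition S :: "real vec set" where
  "S = real_span n (mat_kernel (B * P) \<inter> sign_vecs n)"

definition Z :: "real vec set" where
  "Z = {z \<in> mat_kernel B. \<forall>t<r. z $ t \<in> \<int> \<and> \<bar>z $ t\<bar> \<le> real (k t)}"

lemma P: "P \<in> carrier_mat r n" by simp

lemma P_mult_carrier[simp]: "x \<in> carrier_vec n \<Longrightarrow> P *\<^sub>v x \<in> carrier_vec r"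
  using mult_mat_vec_carrier[OF P] .

lemma mem_kernel_BP: "x \<in> mat_kernel (B * P) \<longleftrightarrow> x \<in> carrier_vec n \<and> P *\<^sub>v x \<in> mat_kernel B"
  by (auto simp: mat_kernel[OF B] mat_kernel[OF mult_carrier_mat[OF B P]]
      assoc_mult_mat_vec[OF B P])

lemma Z_subset: "Z \<subseteq> carrier_vec r"
  using B by (auto simp: Z_def mat_kernel[OF B])

lemma signs_subset: "mat_kernel (B * P) \<inter> sign_vecs n \<subseteq> carrier_vec n"
  by (auto simp: sign_vecs_def)

lemma finite_signs: "finite (mat_kernel (B * P) \<inter> sign_vecs n)"
  by (simp add: sign_vecs_eq_image_signing)

lemma submodule_S: "submodule class_ring S (module_vec TYPE(real) n)"
  unfolding S_def by (rule real_span_submodule[OF signs_subset])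

lemma submodule_span_Z: "submodule class_ring (real_span r Z) (module_vec TYPE(real) r)"
  by (rule real_span_submodule[OF Z_subset])

text \<open>With $k_t + z_t$ entries $+1$ among the $2k_t$ positions of block $t$, the block sum is
  $(k_t + z_t) - (k_t - z_t) = 2 z_t$.\<close>
lemma signing_mem_S:
  assumes z: "z \<in> mat_kernel B" and F: "\<And>t. t < r \<Longrightarrow> real (card (F \<inter> block n b t)) = real (k t) + z $ t"
  shows "signing n F \<in> S" and "P *\<^sub>v signing n F = 2 \<cdot>\<^sub>v z"
proof -
  have zc: "z \<in> carrier_vec r" using z B by (auto simp: mat_kernel[OF B])
  show *: "P *\<^sub>v signing n F = 2 \<cdot>\<^sub>v z"
    using zc F by (intro eq_vecI)
      (auto simp: block_sum_mat_mult_vec[OF signing_carrier] sum_signing_block card_block)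
  have "signing n F \<in> mat_kernel (B * P)"
    unfolding mem_kernel_BP * using mat_kernel_smult[OF B z] by simp
  thus "signing n F \<in> S"
    using real_span_superset[OF signs_subset] signing_mem_sign_vecs unfolding S_def by blast
qed

lemma obtain_block_selection:
  assumes "\<And>t. t < r \<Longrightarrow> c t \<le> 2 * k t"
  obtains F where "\<And>t. t < r \<Longrightarrow> card (F \<inter> block n b t) = c t"
proof -
  have "\<exists>A. A \<subseteq> block n b t \<and> card A = c t" if "t < r" for t
    using assms[OF that] card_block[OF that] obtain_subset_with_card_n by metis
  then obtain A where A: "\<And>t. t < r \<Longrightarrow> A t \<subseteq> block n b t \<and> card (A t) = c t" by metis
  have "(\<Union>s<r. A s) \<inter> block n b t = A t" if "t < r" for t
    using A that by (fastforce simp: block_def)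
  thus thesis using that[of "\<Union>s<r. A s"] A by simp
qed

text \<open>Two balanced sign vectors that differ only by exchanging $+1$ at $i$ with $-1$ at $j$ have
  difference $2(e_i - e_j)$.\<close>
lemma unit_vec_diff_mem_S:
  assumes ij: "i < n" "j < n" "i \<noteq> j" "b i = b j"
  shows "unit_vec n i - unit_vec n j \<in> S"
proof -
  obtain F where F: "\<And>t. t < r \<Longrightarrow> card (F \<inter> block n b t) = k t"
    using obtain_block_selection[of k] by auto
  let ?C = "block n b (b i)"
  have bi: "b i < r" using block_lt ij by blast
  have "card (?C - {i, j}) = 2 * k (b i) - 2"
    using card_block[OF bi] ij by (subst card_Diff_subset) (auto simp: block_def)
  hence "k (b i) - 1 \<le> card (?C - {i, j})" by simp
  then obtain A where A: "A \<subseteq> ?C - {i, j}" "card A = k (b i) - 1"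
    by (rule obtain_subset_with_card_n) blast
  have fA: "finite A" using A(1) finite_subset[OF _ finite_block[of n b "b i"]] by blast
  \<comment> \<open>\<open>A\<close> provides $k_t - 1$ positions of the common block other than \<open>i\<close> and \<open>j\<close>; adding \<open>i\<close> or
    \<open>j\<close> balances that block, and \<open>F\<close> balances the others.\<close>
  define F' where "F' l = (F - ?C) \<union> insert l A" for l
  have F': "real (card (F' l \<inter> block n b t)) = real (k t) + 0\<^sub>v r $ t" if l: "l \<in> {i, j}" and t: "t < r" for l t
  proof (cases "t = b i")
    case True
    have "F' l \<inter> ?C = insert l A" using A l ij by (auto simp: F'_def block_def)
    moreover have "card (insert l A) = k (b i)" using A l fA k_pos[OF bi] by (auto simp: card_insert_if)
    ultimately show ?thesis using True t by simp
  next
    case False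
    have "F' l \<inter> block n b t = F \<inter> block n b t"
      using A(1) l ij False by (auto simp: F'_def block_def)
    thus ?thesis using F t by simp
  qed
  have "0\<^sub>v r \<in> mat_kernel B" using submodule_mat_kernel[OF B] by (simp add: submodule_vec_iff)
  hence mem: "signing n (F' i) \<in> S" "signing n (F' j) \<in> S"
    using signing_mem_S(1) F' by blast+
  have "unit_vec n i - unit_vec n j = (1/2) \<cdot>\<^sub>v (signing n (F' i) + (- 1) \<cdot>\<^sub>v signing n (F' j))"
    using ij A by (intro eq_vecI) (auto simp: signing_def F'_def block_def)
  thus ?thesis using mem submodule_S unfolding submodule_vec_iff by metis
qed

lemma kernel_P_subset_S: "mat_kernel P \<subseteq> S"
  by (rule mat_kernel_block_sum_mat_subset[OF submodule_S unit_vec_diff_mem_S block_lt])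

lemma P_surj: "(\<lambda>x. P *\<^sub>v x) ` carrier_vec n = carrier_vec r"
proof
  show "carrier_vec r \<subseteq> (\<lambda>x. P *\<^sub>v x) ` carrier_vec n"
  proof
    fix y :: "real vec" assume y: "y \<in> carrier_vec r"
    \<comment> \<open>Spread each $y_t$ evenly over the $2k_t > 0$ positions of its block.\<close>
    define x where "x = vec n (\<lambda>j. y $ b j / real (2 * k (b j)))"
    have x: "x \<in> carrier_vec n" by (simp add: x_def)
    have "(\<Sum>j\<in>block n b t. x $ j) = y $ t" if t: "t < r" for t
    proof -
      have "(\<Sum>j\<in>block n b t. x $ j) = (\<Sum>j\<in>block n b t. y $ t / real (2 * k t))"
        by (intro sum.cong) (auto simp: x_def block_def)
      thus ?thesis using card_block[OF t] k_pos[OF t] by simp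
    qed
    hence "P *\<^sub>v x = y" using y by (intro eq_vecI) (auto simp: block_sum_mat_mult_vec[OF x])
    thus "y \<in> (\<lambda>x. P *\<^sub>v x) ` carrier_vec n" using x by blast
  qed
qed auto

text \<open>For a sign vector $x$ in the kernel, $\frac12 (Px)_t$ is the number of entries $+1$ in block
  $t$ minus $k_t$: an integer between $-k_t$ and $k_t$.\<close>
lemma S_subset: "S \<subseteq> {x \<in> carrier_vec n. P *\<^sub>v x \<in> real_span r Z}"
  unfolding S_def
proof (rule real_span_minimal[OF _ submodule_vimage[OF P submodule_span_Z]], safe)
  fix x assume xK: "x \<in> mat_kernel (B * P)" and "x \<in> sign_vecs n"
  then obtain F where F: "x = signing n F" by (auto simp: sign_vecs_eq_image_signing)
  define z where "z = (1/2) \<cdot>\<^sub>v (P *\<^sub>v x)"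
  have zt: "z $ t = real (card (F \<inter> block n b t)) - real (k t)" if "t < r" for t
    using that
    by (simp add: z_def F block_sum_mat_mult_vec[OF signing_carrier] sum_signing_block card_block field_simps)
  have "z \<in> Z" unfolding Z_def
  proof (safe)
    show "z \<in> mat_kernel B"
      using xK mat_kernel_smult[OF B] unfolding mem_kernel_BP z_def by blast
    fix t assume t: "t < r"
    show "z $ t \<in> \<int>" by (simp add: zt[OF t])
    have "card (F \<inter> block n b t) \<le> 2 * k t"
      using card_mono[of "block n b t" "F \<inter> block n b t"] card_block[OF t] by auto
    thus "\<bar>z $ t\<bar> \<le> real (k t)" by (simp add: zt[OF t] abs_le_iff)
  qed
  hence "z \<in> real_span r Z" using real_span_superset[OF Z_subset] by blast
  moreover have "P *\<^sub>v x = 2 \<cdot>\<^sub>v z"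
    by (auto simp: z_def smult_smult_assoc)
  ultimately show "P *\<^sub>v x \<in> real_span r Z"
    using submodule_span_Z unfolding submodule_vec_iff by metis
  show "x \<in> carrier_vec n" by (simp add: F)
qed

lemma real_span_Z_subset: "real_span r Z \<subseteq> (\<lambda>x. P *\<^sub>v x) ` S"
proof (rule real_span_minimal)
  have S: "S \<subseteq> carrier_vec n" using submodule_S by (simp add: submodule_vec_iff)
  show "submodule class_ring ((\<lambda>x. P *\<^sub>v x) ` S) (module_vec TYPE(real) r)"
    unfolding submodule_vec_iff
  proof (intro conjI ballI allI)
    show "(\<lambda>x. P *\<^sub>v x) ` S \<subseteq> carrier_vec r" using S by auto
    show "0\<^sub>v r \<in> (\<lambda>x. P *\<^sub>v x) ` S"
    proof
      show "0\<^sub>v r = P *\<^sub>v 0\<^sub>v n" by (intro eq_vecI) (auto simp: block_sum_mat_def)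
    qed (use submodule_S in \<open>simp add: submodule_vec_iff\<close>)
    fix v assume v: "v \<in> (\<lambda>x. P *\<^sub>v x) ` S"
    then obtain x where x: "x \<in> S" "v = P *\<^sub>v x" by blast
    show "c \<cdot>\<^sub>v v \<in> (\<lambda>x. P *\<^sub>v x) ` S" for c
      using x S submodule_S
      by (intro image_eqI[of _ _ "c \<cdot>\<^sub>v x"]) (auto simp: submodule_vec_iff mult_mat_vec[OF P])
    fix w assume "w \<in> (\<lambda>x. P *\<^sub>v x) ` S"
    then obtain y where y: "y \<in> S" "w = P *\<^sub>v y" by blast
    show "v + w \<in> (\<lambda>x. P *\<^sub>v x) ` S"
    proof
      have "x \<in> carrier_vec n" "y \<in> carrier_vec n" using x y S by auto
      thus "v + w = P *\<^sub>v (x + y)" by (simp add: x y mult_add_distrib_mat_vec[OF P])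
    qed (use x y submodule_S in \<open>simp add: submodule_vec_iff\<close>)
  qed
  show "Z \<subseteq> (\<lambda>x. P *\<^sub>v x) ` S"
  proof
    fix z assume z: "z \<in> Z"
    hence zK: "z \<in> mat_kernel B" by (simp add: Z_def)
    have "\<exists>c::nat. real c = real (k t) + z $ t \<and> c \<le> 2 * k t" if t: "t < r" for t
    proof -
      have zt: "z $ t \<in> \<int>" "\<bar>z $ t\<bar> \<le> real (k t)" using z t by (auto simp: Z_def)
      from zt(1) obtain a :: int where a: "z $ t = of_int a" by (rule Ints_cases)
      with zt(2) have "\<bar>a\<bar> \<le> int (k t)" by linarith
      thus ?thesis by (intro exI[of _ "nat (int (k t) + a)"]) (auto simp: a)
    qed
    then obtain c where c: "\<And>t. t < r \<Longrightarrow> real (c t) = real (k t) + z $ t \<and> c t \<le> 2 * k t"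
      by metis
    obtain F where F: "\<And>t. t < r \<Longrightarrow> card (F \<inter> block n b t) = c t"
      using obtain_block_selection[of c] c by blast
    have *: "signing n F \<in> S" "P *\<^sub>v signing n F = 2 \<cdot>\<^sub>v z"
      using signing_mem_S[OF zK, of F] F c by auto
    have "P *\<^sub>v ((1/2) \<cdot>\<^sub>v signing n F) = z"
      by (simp add: mult_mat_vec[OF P] * smult_smult_assoc)
    moreover have "(1/2) \<cdot>\<^sub>v signing n F \<in> S"
      using * submodule_S by (simp add: submodule_vec_iff)
    ultimately show "z \<in> (\<lambda>x. P *\<^sub>v x) ` S" by (metis image_eqI)
  qed
qed

text \<open>A vector with block sums in $L_k(B)$ has the same block sums as some vector of $S$, and the
  difference of the two lies in $\ker P \subseteq S$.\<close>
lemma S_eq_vimage: "S = {x \<in> carrier_vec n. P *\<^sub>v x \<in> real_span r Z}"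
proof
  show "{x \<in> carrier_vec n. P *\<^sub>v x \<in> real_span r Z} \<subseteq> S"
  proof safe
  fix x :: "real vec" assume x: "x \<in> carrier_vec n" and "P *\<^sub>v x \<in> real_span r Z"
    then obtain y where y: "y \<in> S" "P *\<^sub>v x = P *\<^sub>v y" using real_span_Z_subset by blast
    have yc: "y \<in> carrier_vec n" using y submodule_S by (auto simp: submodule_vec_iff)
    have "x - y \<in> mat_kernel P"
      using x yc y minus_cancel_vec[OF P_mult_carrier[OF yc]]
      by (intro mat_kernelI[OF P]) (auto simp: mult_minus_distrib_mat_vec[OF P])
    hence "x - y \<in> S" using kernel_P_subset_S by blast
    moreover have "x = y + (x - y)" using x yc by (intro eq_vecI) auto
    ultimately show "x \<in> S" using y submodule_S unfolding submodule_vec_iff by metis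
  qed
qed (rule S_subset)

lemma image_S: "(\<lambda>x. P *\<^sub>v x) ` S = real_span r Z"
proof
  show "(\<lambda>x. P *\<^sub>v x) ` S \<subseteq> real_span r Z"
    using S_subset by auto
qed (rule real_span_Z_subset)

lemma dim_S: "subspace_dim n S + r = n + subspace_dim r (real_span r Z)"
proof -
  have "{x \<in> S. P *\<^sub>v x = 0\<^sub>v r} = mat_kernel P"
    using kernel_P_subset_S S_subset by (auto simp: mat_kernel[OF P])
  thus ?thesis
    using subspace_dim_image_kernel[OF P signs_subset finite_signs]
      subspace_dim_mat_kernel_of_surj[OF P P_surj] image_S
    unfolding S_def by simp
qed

lemma S_eq_kernel_iff: "S = mat_kernel (B * P) \<longleftrightarrow> real_span r Z = mat_kernel B"
proof
  assume eq: "S = mat_kernel (B * P)"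
  have "(\<lambda>x. P *\<^sub>v x) ` mat_kernel (B * P) = mat_kernel B"
  proof
    show "mat_kernel B \<subseteq> (\<lambda>x. P *\<^sub>v x) ` mat_kernel (B * P)"
    proof
      fix y assume y: "y \<in> mat_kernel B"
      hence "y \<in> (\<lambda>x. P *\<^sub>v x) ` carrier_vec n"
        using P_surj mat_kernel_carrier[OF B] by blast
      thus "y \<in> (\<lambda>x. P *\<^sub>v x) ` mat_kernel (B * P)" using y mem_kernel_BP by blast
    qed
  qed (auto simp: mem_kernel_BP)
  thus "real_span r Z = mat_kernel B" using image_S eq by simp
next
  assume "real_span r Z = mat_kernel B"
  thus "S = mat_kernel (B * P)" unfolding S_eq_vimage by (auto simp: mem_kernel_BP)
qed

end

section \<open>Repeated columns\<close>

text \<open>Entry $j$ is the index of the column of $B$ of which column $j$ of $B^{(m)}$ is a copy.\<close>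
definition block_list :: "nat \<Rightarrow> nat vec \<Rightarrow> nat list" where
  "block_list r m = concat (map (\<lambda>t. replicate (m $ t) t) [0..<r])"

lemma length_block_list: "length (block_list r m) = (\<Sum>t<r. m $ t)"
  by (simp add: block_list_def length_concat comp_def interv_sum_list_conv_sum_set_nat
      lessThan_atLeast0)

lemma set_block_list: "set (block_list r m) \<subseteq> {..<r}"
  by (auto simp: block_list_def)

lemma count_block_list: "t < r \<Longrightarrow> count_list (block_list r m) t = m $ t"
proof (induction r)
  case (Suc r)
  have rep: "count_list (replicate a s) u = (if s = u then a else 0)" for a s u :: nat
    by (induction a) auto
  have "t \<notin> set (block_list r m)" if "t = r" using set_block_list that by auto
  thus ?case using Suc by (cases "t = r") (auto simp: block_list_def rep)
qed simp

lemma card_block_nth: "card (block (length xs) ((!) xs) t) = count_list xs t"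
proof -
  have "block (length xs) ((!) xs) t = {i. i < length xs \<and> t = xs ! i}"
    by (auto simp: block_def)
  thus ?thesis by (simp add: count_list_eq_length_filter length_filter_conv_card)
qed

text \<open>Repeating columns is multiplication by the block sum matrix: its column $j$ is the unit vector
  that selects the column of $B$ to be copied. This is what turns $\ker B^{(m)}$ into a preimage.\<close>
lemma repeat_cols_eq_mult_block_sum_mat:
  fixes m :: "nat vec"
  assumes B: "B \<in> carrier_mat d r"
  defines "xs \<equiv> block_list r m"
  shows "repeat_cols B m = B * block_sum_mat r (length xs) ((!) xs)"
proof -
  have cols: "concat (map (\<lambda>t. replicate (m $ t) (col B t)) [0..<r]) = map (col B) xs"
    by (simp add: xs_def block_list_def map_concat comp_def)
  show ?thesis
  proof (rule eq_matI)
    fix i j assume "i < dim_row (B * block_sum_mat r (length xs) ((!) xs))"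
      and "j < dim_col (B * block_sum_mat r (length xs) ((!) xs))"
    hence i: "i < d" and j: "j < length xs" using B by (auto simp: block_sum_mat_def)
    have lt: "xs ! j < r" using set_block_list[of r m] j nth_mem unfolding xs_def by blast
    have "(B * block_sum_mat r (length xs) ((!) xs)) $$ (i, j)
        = (\<Sum>t<r. if xs ! j = t then B $$ (i, t) else 0)"
      using i j B
      by (simp add: block_sum_mat_def scalar_prod_def lessThan_atLeast0 if_distrib[of "(*) _"]
          cong: if_cong)
    also have "\<dots> = B $$ (i, xs ! j)" using lt by simp
    finally show "repeat_cols B m $$ (i, j) = (B * block_sum_mat r (length xs) ((!) xs)) $$ (i, j)"
      using B i j lt by (simp add: repeat_cols_def cols mat_of_cols_def)
  qed (use B in \<open>simp_all add: repeat_cols_def cols block_sum_mat_def\<close>)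
qed

theorem theorem3p8:
  fixes B :: "real mat" and k :: "nat vec" and Y :: "real mat" and d r n :: nat
  assumes "B \<in> carrier_mat d r"
    and "k \<in> carrier_vec r"
    and "\<forall>t<r. 0 < k $ t"
    and "Y = repeat_cols B (2 \<cdot>\<^sub>v k)"
    and "n = 2 * (\<Sum>t<r. k $ t)"
  shows "sigma Y = (\<Sum>t<r. 2 * k $ t - 1) + subspace_dim r (L k B)
    \<and> (real_span n (mat_kernel Y \<inter> sign_vecs n) = mat_kernel Y \<longleftrightarrow> L k B = mat_kernel B)"
proof -
  define xs where "xs = block_list r (2 \<cdot>\<^sub>v k)"
  have n: "length xs = n"
    using assms(2,5) by (simp add: xs_def length_block_list sum_distrib_left)
  have Y: "Y = B * block_sum_mat r n ((!) xs)"
    using repeat_cols_eq_mult_block_sum_mat[OF assms(1)] n unfolding assms(4) xs_def by metis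
  interpret even_blocks r n "(!) xs" "\<lambda>t. k $ t" B d
  proof
    show "xs ! j < r" if "j < n" for j
      using that set_block_list[of r] nth_mem n unfolding xs_def by blast
    show "card (block n ((!) xs) t) = 2 * k $ t" if "t < r" for t
      using that assms(2) card_block_nth[of xs t] n count_block_list[OF that, of "2 \<cdot>\<^sub>v k"]
      by (simp add: xs_def)
  qed (use assms in auto)
  have dimY: "dim_col Y = n" by (simp add: Y block_sum_mat_def)
  have LZ: "L k B = real_span r Z" using assms(1) by (simp add: L_def Z_def)
  have SY: "real_span n (mat_kernel Y \<inter> sign_vecs n) = S" by (simp add: S_def Y)
  \<comment> \<open>The subtraction is on natural numbers; it does not truncate because each \<open>k $ t\<close> is positive.\<close>
  have "(\<Sum>t<r. 2 * k $ t - 1) + r = (\<Sum>t<r. (2 * k $ t - 1) + 1)"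
    by (simp only: sum.distrib) simp
  also have "\<dots> = (\<Sum>t<r. 2 * k $ t)" using assms(3) by (intro sum.cong) auto
  also have "\<dots> = n" by (simp add: assms(5) sum_distrib_left)
  finally have "sigma Y = (\<Sum>t<r. 2 * k $ t - 1) + subspace_dim r (L k B)"
    using dim_S unfolding sigma_def dimY SY LZ by simp
  moreover have "S = mat_kernel Y \<longleftrightarrow> L k B = mat_kernel B"
    unfolding LZ Y by (rule S_eq_kernel_iff)
  ultimately show ?thesis unfolding SY by blast
qed

end
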